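(* Let $n\ge 1$ be an integer. For every fixed parameter $w\in\mathbb{C}$ set $f(z)=F_n(z,w)$, $z\in\mathbb{C}$. Then a particular solution of the problem $\overline{\partial}u=f$ on $\mathbb{C}$ is given by $$u_n(z,\overline{z})=e^{z\overline{w}}\sum_{s=1}^n\frac{\overline{z}^s}{s!}(z-w)^{s-1}L^s_{n-s}(|z-w|^2).$$
   Context: $\overline{\partial}=\frac{\partial}{\partial\overline z}=\frac12\left(\frac{\partial}{\partial x}+i\frac{\partial}{\partial y}\right)$, $z=x+iy$, acts in the variable $z$. For $n\ge1$, the reproducing kernel of the polyanalytic Fock space of order $n$ is $$F_n(z,w)=e^{z\overline{w}}\sum_{k=0}^{n-1}\frac{(-1)^k}{k!}\binom{n}{k+1}|z-w|^{2k},\qquad z,w\in\mathbb{C}.$$ The generalized Laguerre polynomials are $$L^\alpha_m(x)=\sum_{k=0}^m\frac{(-x)^k}{k!}\binom{m+\alpha}{m-k}.$$ *)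

theory Defs
  imports "HOL-Analysis.Analysis"
begin

definition partial_x :: "(complex \<Rightarrow> complex) \<Rightarrow> complex \<Rightarrow> complex" where
  "partial_x u z = vector_derivative (\<lambda>x. u (Complex x (Im z))) (at (Re z))"

definition partial_y :: "(complex \<Rightarrow> complex) \<Rightarrow> complex \<Rightarrow> complex" where
  "partial_y u z = vector_derivative (\<lambda>y. u (Complex (Re z) y)) (at (Im z))"

definition dbar :: "(complex \<Rightarrow> complex) \<Rightarrow> complex \<Rightarrow> complex" where
  "dbar u z = (1/2) * (partial_x u z + \<i> * partial_y u z)"

(* The differentiability requirement is over the reals (u as a map R^2 -> R^2), not complex
   differentiability; it guarantees that both partial derivatives exist, as
   vector_derivative is unspecified otherwise. *)
definition dbar_solution :: "(complex \<Rightarrow> complex) \<Rightarrow> (complex \<Rightarrow> complex) \<Rightarrow> bool" where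
  "dbar_solution f u \<longleftrightarrow> (\<forall>z. u differentiable (at z) \<and> dbar u z = f z)"

definition polyFock_kernel :: "nat \<Rightarrow> complex \<Rightarrow> complex \<Rightarrow> complex" where
  "polyFock_kernel n z w =
     exp (z * cnj w) *
     (\<Sum>k = 0..n - 1. (-1) ^ k / fact k * of_nat (n choose (k + 1)) * of_real (cmod (z - w) ^ (2 * k)))"

definition laguerre :: "real \<Rightarrow> nat \<Rightarrow> real \<Rightarrow> real" where
  "laguerre \<alpha> m x = (\<Sum>k = 0..m. (- x) ^ k / fact k * ((of_nat m + \<alpha>) gchoose (m - k)))"

end

theory Submission
  imports Defs
begin

text \<open>Put $v = z - w$. Since $\frac{d}{dx} L^s_{n-s}(x) = -L^{s+1}_{n-s-1}(x)$, applying
  $\overline\partial$ to the summand with index $s$ gives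
  $e^{z\overline w} (T_{s-1} - T_s)$ with $T_s = \frac{\overline z^s}{s!} v^s L^{s+1}_{n-s-1}(|v|^2)$.
  The sum telescopes to $e^{z\overline w} (T_0 - T_n)$, where $T_n = 0$ and
  $T_0 = L^1_{n-1}(|v|^2)$ is the polynomial factor of the kernel.\<close>

text \<open>Every real-linear map of the plane has the form \<open>A * h + B * cnj h\<close>, with
  \<open>A\<close> the value of the z-derivative and \<open>B\<close> that of \<open>dbar\<close>.
  Leaving \<open>A\<close> existential records real differentiability and the \<open>dbar\<close>
  value at once.\<close>

definition has_dbar :: "(complex \<Rightarrow> complex) \<Rightarrow> complex \<Rightarrow> complex \<Rightarrow> bool" where
  "has_dbar f B z \<longleftrightarrow> (\<exists>A. (f has_derivative (\<lambda>h. A * h + B * cnj h)) (at z))"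

lemma has_dbar_imp_differentiable: "has_dbar f B z \<Longrightarrow> f differentiable (at z)"
  by (auto simp: has_dbar_def differentiable_def)

text \<open>Along the horizontal and vertical lines through \<open>z\<close> the derivative takes
  the values \<open>A + B\<close> and \<open>\<i> * (A - B)\<close>; in \<open>dbar\<close> the
  \<open>A\<close> parts cancel.\<close>

lemma has_dbar_imp_dbar:
  assumes "has_dbar f B z"
  shows "dbar f z = B"
proof -
  obtain A where A: "(f has_derivative (\<lambda>h. A * h + B * cnj h)) (at z)"
    using assms by (auto simp: has_dbar_def)
  have along: "((\<lambda>t. f (g t)) has_vector_derivative (A * d + B * cnj d)) (at t)"
    if "(g has_vector_derivative d) (at t)" "g t = z" for g d t
  proof -
    have "(f has_derivative (\<lambda>h. A * h + B * cnj h)) (at (g t))"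
      using A that(2) by simp
    from has_derivative_compose[OF that(1)[unfolded has_vector_derivative_def] this]
    show ?thesis
      by (simp add: has_vector_derivative_def scaleR_conv_of_real algebra_simps)
  qed
  have "((\<lambda>x. Complex x (Im z)) has_vector_derivative 1) (at (Re z))"
    unfolding Complex_eq by (auto intro!: derivative_eq_intros)
  from along[OF this] have x: "partial_x f z = A + B"
    by (simp add: partial_x_def vector_derivative_at)
  have "((\<lambda>y. Complex (Re z) y) has_vector_derivative \<i>) (at (Im z))"
    unfolding Complex_eq by (auto intro!: derivative_eq_intros)
  from along[OF this] have y: "partial_y f z = A * \<i> - B * \<i>"
    by (simp add: partial_y_def vector_derivative_at)
  show ?thesis
    by (simp add: dbar_def x y algebra_simps)
qed

lemma has_dbar_field_differentiable:
  "f field_differentiable (at z) \<Longrightarrow> has_dbar f 0 z"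
  by (auto simp: has_dbar_def field_differentiable_def has_field_derivative_def)

lemma has_dbar_cnj: "has_dbar cnj 1 z"
  unfolding has_dbar_def
  by (rule exI[of _ 0]) (auto intro!: derivative_eq_intros)

lemma has_dbar_mult:
  assumes "has_dbar f B z" "has_dbar g C z"
  shows "has_dbar (\<lambda>z. f z * g z) (f z * C + B * g z) z"
proof -
  obtain A A' where "(f has_derivative (\<lambda>h. A * h + B * cnj h)) (at z)"
    "(g has_derivative (\<lambda>h. A' * h + C * cnj h)) (at z)"
    using assms by (auto simp: has_dbar_def)
  from has_derivative_mult[OF this]
  have "((\<lambda>z. f z * g z) has_derivative
      (\<lambda>h. (f z * A' + A * g z) * h + (f z * C + B * g z) * cnj h)) (at z)"
    by (simp add: algebra_simps)
  then show ?thesis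
    unfolding has_dbar_def by blast
qed

text \<open>The outer function is holomorphic, so its derivative is multiplication by
  \<open>D\<close>, which scales the conjugate-linear part of the inner derivative.\<close>

lemma has_dbar_compose:
  assumes "has_dbar f B z" "(g has_field_derivative D) (at (f z))"
  shows "has_dbar (\<lambda>z. g (f z)) (D * B) z"
proof -
  obtain A where "(f has_derivative (\<lambda>h. A * h + B * cnj h)) (at z)"
    using assms by (auto simp: has_dbar_def)
  from has_derivative_compose[OF this assms(2)[unfolded has_field_derivative_def]]
  have "((\<lambda>z. g (f z)) has_derivative (\<lambda>h. (D * A) * h + (D * B) * cnj h)) (at z)"
    by (simp add: algebra_simps)
  then show ?thesis
    unfolding has_dbar_def by blast
qed

lemma has_dbar_sum:
  assumes "\<And>i. i \<in> I \<Longrightarrow> has_dbar (f i) (B i) z"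
  shows "has_dbar (\<lambda>z. \<Sum>i\<in>I. f i z) (\<Sum>i\<in>I. B i) z"
proof -
  obtain A where "\<And>i. i \<in> I \<Longrightarrow> (f i has_derivative (\<lambda>h. A i * h + B i * cnj h)) (at z)"
    using assms unfolding has_dbar_def by metis
  from has_derivative_sum[of I, OF this]
  have "((\<lambda>z. \<Sum>i\<in>I. f i z) has_derivative
      (\<lambda>h. (\<Sum>i\<in>I. A i) * h + (\<Sum>i\<in>I. B i) * cnj h)) (at z)"
    by (simp add: sum.distrib sum_distrib_right)
  then show ?thesis
    unfolding has_dbar_def by blast
qed

text \<open>For $s \<le> n$ this is $L^s_{n-s}$; summing up to $n$ rather than $n - s$ makes the
  derivative formula below hold for every $s$, with value $0$ at $s = n$.\<close>

definition laguerre_poly :: "nat \<Rightarrow> nat \<Rightarrow> complex \<Rightarrow> complex" where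
  "laguerre_poly n s x = (\<Sum>k\<le>n. (- x) ^ k / fact k * of_nat (n choose (s + k)))"

lemma laguerre_poly_eq_sum:
  assumes "s \<le> n"
  shows "laguerre_poly n s x = (\<Sum>k = 0..n - s. (- x) ^ k / fact k * of_nat (n choose (s + k)))"
  unfolding laguerre_poly_def by (rule sum.mono_neutral_right) auto

text \<open>Here m + \<alpha> = n is a natural number, so the generalized binomial is an ordinary
  one, and symmetry turns n - s - k into s + k.\<close>

lemma of_real_laguerre:
  assumes "s \<le> n"
  shows "of_real (laguerre (of_nat s) (n - s) x) = laguerre_poly n s (of_real x)"
proof -
  have "(of_nat (n - s) + of_nat s) gchoose (n - s - k) = (of_nat (n choose (s + k)) :: real)"
    if "k \<le> n - s" for k
  proof -
    have "n choose (s + k) = n choose (n - s - k)"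
      using that assms binomial_symmetric[of "s + k" n] by simp
    moreover have "of_nat (n - s) + of_nat s = (of_nat n :: real)"
      using assms by simp
    ultimately show ?thesis
      by (metis binomial_gbinomial)
  qed
  then show ?thesis
    unfolding laguerre_poly_eq_sum[OF assms] laguerre_def by simp
qed

lemma has_field_derivative_power_fact:
  fixes x :: complex
  shows "((\<lambda>x. x ^ Suc r / fact (Suc r)) has_field_derivative x ^ r / fact r) (at x)"
proof -
  have "((\<lambda>x. x ^ Suc r / fact (Suc r)) has_field_derivative
      of_nat (Suc r) * x ^ r / fact (Suc r)) (at x)"
    by (rule DERIV_cdivide) (auto intro!: derivative_eq_intros simp del: power_Suc)
  also have "of_nat (Suc r) * x ^ r / fact (Suc r) = x ^ r / fact r"
    by (simp add: fact_Suc del: of_nat_Suc)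
  finally show ?thesis .
qed

lemma laguerre_poly_has_field_derivative:
  "(laguerre_poly n s has_field_derivative - laguerre_poly n (Suc s) x) (at x)"
proof -
  have term_deriv: "((\<lambda>x. (- x) ^ k / fact k * c) has_field_derivative
      (if k = 0 then 0 else - ((- x) ^ (k - 1) / fact (k - 1) * c))) (at x)" for k and c :: complex
  proof (cases k)
    case (Suc r)
    have "((\<lambda>x. - x) has_field_derivative - 1) (at x)"
      by (auto intro!: derivative_eq_intros)
    from DERIV_cmult_right[OF DERIV_chain2[OF has_field_derivative_power_fact this], of r c]
    show ?thesis
      by (simp add: Suc del: fact_Suc power_Suc)
  qed simp
  have "(laguerre_poly n s has_field_derivative (\<Sum>k\<le>n. if k = 0 then 0
      else - ((- x) ^ (k - 1) / fact (k - 1) * of_nat (n choose (s + k))))) (at x)"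
    unfolding laguerre_poly_def[abs_def] by (rule DERIV_sum) (rule term_deriv)
  also have "(\<Sum>k\<le>n. if k = 0 then 0
      else - ((- x) ^ (k - 1) / fact (k - 1) * of_nat (n choose (s + k))))
    = (\<Sum>k<n. - ((- x) ^ k / fact k * of_nat (n choose (Suc s + k))))"
    by (subst sum.atMost_shift) simp
  \<comment> \<open>The term k = n absent on the left vanishes, because
    \<open>n choose (Suc s + n)\<close> is 0.\<close>
  also have "\<dots> = - laguerre_poly n (Suc s) x"
    by (simp add: laguerre_poly_def sum_negf flip: lessThan_Suc_atMost)
  finally show ?thesis .
qed

text \<open>All binomials vanish. At index n + 1 this removes the last term of the telescoping
  sum.\<close>

lemma laguerre_poly_eq_0: "n < s \<Longrightarrow> laguerre_poly n s x = 0"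
  unfolding laguerre_poly_def by (rule sum.neutral) (simp add: binomial_eq_0)

lemma polyFock_kernel_eq:
  assumes "n \<ge> 1"
  shows "polyFock_kernel n z w = exp (z * cnj w) * laguerre_poly n 1 ((z - w) * cnj (z - w))"
proof -
  have "(-1) ^ k / fact k * of_nat (n choose (k + 1)) * of_real (cmod (z - w) ^ (2 * k))
      = (- ((z - w) * cnj (z - w))) ^ k / fact k * of_nat (n choose (1 + k))" for k
  proof -
    have "complex_of_real (cmod (z - w) ^ (2 * k)) = ((z - w) * cnj (z - w)) ^ k"
      by (simp only: power_mult of_real_power flip: complex_norm_square)
    then show ?thesis
      by (subst power_minus) (simp add: mult_ac)
  qed
  then show ?thesis
    unfolding polyFock_kernel_def laguerre_poly_eq_sum[OF assms] by (simp only:)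
qed

text \<open>In the product rule, differentiating the power of \<open>cnj z\<close> lowers its index
  and gives \<open>T (s - 1)\<close>. The power of \<open>z - w\<close> is holomorphic. The Laguerre
  factor yields -(z - w) times the next Laguerre polynomial, which gives
  \<open>- T s\<close>.\<close>

lemma has_dbar_summand:
  fixes n :: nat and w :: complex
  assumes "s \<ge> 1"
  defines "T \<equiv> \<lambda>s z. cnj z ^ s / fact s * (z - w) ^ s *
    laguerre_poly n (Suc s) ((z - w) * cnj (z - w))"
  shows "has_dbar (\<lambda>z. cnj z ^ s / fact s * (z - w) ^ (s - 1) *
    laguerre_poly n s ((z - w) * cnj (z - w))) (T (s - 1) z - T s z) z"
proof -
  obtain r where s: "s = Suc r"
    using assms(1) by (cases s) auto
  have holo: "has_dbar (\<lambda>z. z - w) 0 z" "has_dbar (\<lambda>z. (z - w) ^ r) 0 z"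
    by (intro has_dbar_field_differentiable derivative_intros)+
  \<comment> \<open>\<open>cnj (z - w)\<close> is treated as the holomorphic map
    \<open>x - cnj w\<close> evaluated at x = \<open>cnj z\<close>.\<close>
  have "((\<lambda>x. x - cnj w) has_field_derivative 1) (at (cnj z))"
    by (auto intro!: derivative_eq_intros)
  from has_dbar_mult[OF holo(1) has_dbar_compose[OF has_dbar_cnj this]]
  have "has_dbar (\<lambda>z. (z - w) * cnj (z - w)) (z - w) z"
    by simp
  note lag = has_dbar_compose[OF this laguerre_poly_has_field_derivative[of n s]]
  have "((\<lambda>x. x ^ s / fact s) has_field_derivative cnj z ^ r / fact r) (at (cnj z))"
    unfolding s by (rule has_field_derivative_power_fact)
  note pow = has_dbar_compose[OF has_dbar_cnj this]
  show ?thesis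
    using has_dbar_mult[OF has_dbar_mult[OF pow holo(2)] lag]
    by (simp add: T_def s algebra_simps diff_divide_distrib)
qed

theorem theorem4p19:
  fixes n :: nat and w :: complex
  assumes "n \<ge> 1"
  shows "dbar_solution
           (\<lambda>z. polyFock_kernel n z w)
           (\<lambda>z. exp (z * cnj w) *
              (\<Sum>s = 1..n. cnj z ^ s / fact s * (z - w) ^ (s - 1) *
                 of_real (laguerre (of_nat s) (n - s) ((cmod (z - w))\<^sup>2))))"
    (is "dbar_solution _ ?u")
proof -
  define T where "T s z = cnj z ^ s / fact s * (z - w) ^ s *
    laguerre_poly n (Suc s) ((z - w) * cnj (z - w))" for s z
  define U where "U s z = cnj z ^ s / fact s * (z - w) ^ (s - 1) *
    laguerre_poly n s ((z - w) * cnj (z - w))" for s z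
  \<comment> \<open>Replacing the squared modulus by \<open>(z - w) * cnj (z - w)\<close> turns each
    summand into a form covered by the product and chain rules.\<close>
  have u: "?u = (\<lambda>z. exp (z * cnj w) * (\<Sum>s = 1..n. U s z))"
    unfolding U_def
    by (intro ext arg_cong2[where f = times] sum.cong refl)
      (simp only: of_real_laguerre complex_norm_square atLeastAtMost_iff)
  have "has_dbar ?u (polyFock_kernel n z w) z" for z
  proof -
    have "has_dbar (\<lambda>z. \<Sum>s = 1..n. U s z) (\<Sum>s = 1..n. T (s - 1) z - T s z) z"
      unfolding U_def T_def by (intro has_dbar_sum has_dbar_summand) simp
    also have "(\<Sum>s = 1..n. T (s - 1) z - T s z) = T 0 z - T n z"
      by (induction n) auto
    also have "\<dots> = laguerre_poly n 1 ((z - w) * cnj (z - w))"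
      by (simp add: T_def laguerre_poly_eq_0)
    finally have sum: "has_dbar (\<lambda>z. \<Sum>s = 1..n. U s z) \<dots> z" .
    \<comment> \<open>For fixed \<open>w\<close> the exponential is holomorphic in \<open>z\<close>,
      so it passes through \<open>dbar\<close> as a plain factor.\<close>
    have "has_dbar (\<lambda>z. exp (z * cnj w)) 0 z"
      by (intro has_dbar_field_differentiable field_differentiable_within_exp
          field_differentiable_compose[of _ _ exp, unfolded o_def] derivative_intros)
    from has_dbar_mult[OF this sum] show ?thesis
      unfolding u polyFock_kernel_eq[OF assms] by simp
  qed
  then show ?thesis
    by (auto simp: dbar_solution_def intro: has_dbar_imp_differentiable has_dbar_imp_dbar)
qed

end
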